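(* Let $K$ be a smooth knot in $\mathbb R^3$ of length $L$, parametrized by arc length by a smooth injective map $\mathbf r:S\to\mathbb R^3$ with $\|\mathbf r'(s)\|=1$, where $S=\mathbb R/L\mathbb Z$. Let $\mathbf z:S\to\mathbb R^3$ be a smooth infinitesimal bending field of $K$, i.e. $\mathbf r'(s)\cdot\mathbf z'(s)=0$ for all $s\in S$, and let $K_\epsilon$ be the knot parametrized by $\mathbf r_\epsilon=\mathbf r+\epsilon\mathbf z$. Then the first variation $\delta E(K)=\frac{d}{d\epsilon}E(K_\epsilon)\big|_{\epsilon=0}$ of the Möbius energy is $$\delta E(K)=2\int_S\int_S\frac{(\mathbf r(t)-\mathbf r(s))\cdot(\mathbf z(s)-\mathbf z(t))}{\|\mathbf r(s)-\mathbf r(t)\|^4}\,ds\,dt .$$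
   Context: An infinitesimal bending of a curve $\mathbf r$ is a family $\mathbf r_\epsilon=\mathbf r+\epsilon\mathbf z$, $\epsilon\ge0$, $\epsilon\to0$, with $ds_\epsilon^2-ds^2=o(\epsilon)$, equivalently $d\mathbf r\cdot d\mathbf z=0$; $\mathbf z$ is called the infinitesimal bending field. Since a family of closed curves is required, $\mathbf z$ is defined on the circle $S$. The Möbius energy of the knot $K_\epsilon$ (with $K_0=K$) parametrized by $\mathbf r_\epsilon:S\to\mathbb R^3$ is $$E(K_\epsilon)=\int_S\int_S\Big(\frac1{\|\mathbf r_\epsilon(s)-\mathbf r_\epsilon(t)\|^2}-\frac1{l_\epsilon(s,t)^2}\Big)\|\mathbf r_\epsilon'(s)\|\,\|\mathbf r_\epsilon'(t)\|\,ds\,dt,$$ where $l_\epsilon(s,t)$ is the minimum distance along $K_\epsilon$ between $\mathbf r_\epsilon(s)$ and $\mathbf r_\epsilon(t)$ (the length of the shorter of the two arcs joining them). Primes denote derivatives with respect to the parameter $s$, the arc length of $K$. *)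

theory Defs
  imports "HOL-Analysis.Analysis"
begin

text \<open>
  The circle \<open>S = \<real>/L\<int>\<close> is modelled by the fundamental domain \<open>{0..L}\<close>; a map on \<open>S\<close> is an
  \<open>L\<close>-periodic map on \<open>real\<close>, so smoothness on \<open>S\<close> includes smoothness across the base point.
\<close>

abbreviation velocity :: "(real \<Rightarrow> real^3) \<Rightarrow> real \<Rightarrow> real^3" where
  "velocity f \<equiv> (\<lambda>s. vector_derivative f (at s))"

text \<open>\<open>C\<^sup>\<infinity>\<close>: every iterated derivative exists and is itself differentiable everywhere.\<close>

definition smooth :: "(real \<Rightarrow> real^3) \<Rightarrow> bool" where
  "smooth f \<longleftrightarrow> (\<forall>n s. (velocity ^^ n) f differentiable (at s))"

definition smooth_on_circle :: "real \<Rightarrow> (real \<Rightarrow> real^3) \<Rightarrow> bool" where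
  "smooth_on_circle L f \<longleftrightarrow> smooth f \<and> (\<forall>s. f (s + L) = f s)"

definition arc_length_knot :: "real \<Rightarrow> (real \<Rightarrow> real^3) \<Rightarrow> bool" where
  "arc_length_knot L r \<longleftrightarrow>
     L > 0 \<and> smooth_on_circle L r \<and> inj_on r {0..<L} \<and> (\<forall>s. norm (velocity r s) = 1)"

definition infinitesimal_bending_field ::
    "real \<Rightarrow> (real \<Rightarrow> real^3) \<Rightarrow> (real \<Rightarrow> real^3) \<Rightarrow> bool" where
  "infinitesimal_bending_field L r z \<longleftrightarrow>
     smooth_on_circle L z \<and> (\<forall>s. velocity r s \<bullet> velocity z s = 0)"

definition bending :: "(real \<Rightarrow> real^3) \<Rightarrow> (real \<Rightarrow> real^3) \<Rightarrow> real \<Rightarrow> real \<Rightarrow> real^3" where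
  "bending r z \<epsilon> = (\<lambda>s. r s + \<epsilon> *\<^sub>R z s)"

definition arc_length :: "(real \<Rightarrow> real^3) \<Rightarrow> real \<Rightarrow> real \<Rightarrow> real" where
  "arc_length \<gamma> a b = set_lebesgue_integral lborel {a..b} (\<lambda>u. norm (velocity \<gamma> u))"

text \<open>
  For \<open>s\<close> and \<open>t\<close> in \<open>{0..L}\<close>, the two arcs of the closed curve joining \<open>\<gamma> s\<close> and \<open>\<gamma> t\<close> are
  parametrized by \<open>{min s t..max s t}\<close> and \<open>{max s t..min s t + L}\<close>.  Only such \<open>s\<close> and \<open>t\<close> occur
  in the energy.
\<close>

definition distance_along :: "real \<Rightarrow> (real \<Rightarrow> real^3) \<Rightarrow> real \<Rightarrow> real \<Rightarrow> real" where
  "distance_along L \<gamma> s t =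
     min (arc_length \<gamma> (min s t) (max s t)) (arc_length \<gamma> (max s t) (min s t + L))"

definition moebius_integrand :: "real \<Rightarrow> (real \<Rightarrow> real^3) \<Rightarrow> real \<times> real \<Rightarrow> real" where
  "moebius_integrand L \<gamma> = (\<lambda>(s, t).
     (1 / (norm (\<gamma> s - \<gamma> t))\<^sup>2 - 1 / (distance_along L \<gamma> s t)\<^sup>2)
       * norm (velocity \<gamma> s) * norm (velocity \<gamma> t))"

definition moebius_energy :: "real \<Rightarrow> (real \<Rightarrow> real^3) \<Rightarrow> real" where
  "moebius_energy L \<gamma> =
     set_lebesgue_integral lborel ({0..L} \<times> {0..L}) (moebius_integrand L \<gamma>)"

definition variation_integrand ::
    "(real \<Rightarrow> real^3) \<Rightarrow> (real \<Rightarrow> real^3) \<Rightarrow> real \<times> real \<Rightarrow> real" where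
  "variation_integrand r z = (\<lambda>(s, t).
     ((r t - r s) \<bullet> (z s - z t)) / (norm (r s - r t)) ^ 4)"

end

theory Submission
  imports Defs
begin

text \<open>
  The first variation may be computed under the integral sign because the integrand of the energy
  of \<open>r + \<epsilon> z\<close> has a first-order expansion in \<open>\<epsilon>\<close> whose remainder is at most \<open>C \<epsilon>\<^sup>2\<close> with one
  constant for all pairs of points (\<open>moebius_integrand_expansion\<close>).

  Away from the diagonal this is easy: orthogonality of \<open>r'\<close> and \<open>z'\<close> gives the bent curve the speed
  \<open>sqrt (1 + \<epsilon>\<^sup>2 \<bar>z'\<bar>\<^sup>2)\<close>, so speeds and lengths change only at order \<open>\<epsilon>\<^sup>2\<close>, and only
  \<open>1 / \<bar>\<Delta>r + \<epsilon> \<Delta>z\<bar>\<^sup>2\<close> contributes the derivative \<open>- 2 (\<Delta>r \<bullet> \<Delta>z) / \<bar>\<Delta>r\<bar>\<^sup>4\<close>.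
  Near the diagonal each of the two fractions has a second-order term of size \<open>\<epsilon>\<^sup>2 / h\<^sup>2\<close>, where \<open>h\<close>
  is the distance on the circle; it is not integrable, and the two terms must cancel. They
  do because of the following estimates, in which \<open>D\<close> is the distance along the bent curve:

  \<^item> \<open>\<bar>\<Delta>r\<bar>\<^sup>2 = h\<^sup>2 + O(h\<^sup>4)\<close> and \<open>\<Delta>r \<bullet> \<Delta>z = O(h\<^sup>4)\<close>;
  \<^item> \<open>D\<^sup>2 = h\<^sup>2 + \<epsilon>\<^sup>2 \<bar>\<Delta>z\<bar>\<^sup>2 + \<epsilon>\<^sup>2 O(h\<^sup>4)\<close>.

  Thus the squared chord \<open>\<bar>\<Delta>r + \<epsilon> \<Delta>z\<bar>\<^sup>2\<close> and \<open>D\<^sup>2\<close> contain the same term \<open>\<epsilon>\<^sup>2 \<bar>\<Delta>z\<bar>\<^sup>2\<close>. Their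
  difference is \<open>h\<^sup>4 (\<kappa> - 2 \<epsilon> \<beta> + \<epsilon>\<^sup>2 \<eta>)\<close> with \<open>\<kappa>\<close>, \<open>\<beta>\<close> and \<open>\<eta>\<close> bounded, their product is \<open>h\<^sup>4\<close> times
  a quantity bounded away from zero, and the powers of \<open>h\<close> cancel in the quotient. The expansion
  becomes an algebraic fact about bounded quantities (\<open>energy_density_expansion\<close>).

  The estimates come from one inequality, \<open>chord_inner_approx\<close>: the product of two chords is the
  length of the interval times the integral of the product of the derivatives, up to a fourth-order
  error. Together with the Cauchy-Schwarz inequality it also bounds \<open>D\<^sup>2\<close> from above; the bound
  from below says that \<open>D\<close> is at least the chord of a graph (\<open>graph_length_sq_bounds\<close>).
\<close>

section \<open>Chords and mean values of derivatives\<close>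

text \<open>The chord of \<open>f\<close> divided by \<open>b - a\<close> is the mean of \<open>f'\<close>, so this is the usual identity
  between the covariance of \<open>f'\<close> and \<open>g'\<close> and the mean of their product.\<close>

lemma covariance_has_integral:
  fixes f g :: "real \<Rightarrow> 'a::real_inner"
  assumes "a < b"
    and f: "\<And>u. u \<in> {a..b} \<Longrightarrow> (f has_vector_derivative f' u) (at u within {a..b})"
    and g: "\<And>u. u \<in> {a..b} \<Longrightarrow> (g has_vector_derivative g' u) (at u within {a..b})"
    and "continuous_on {a..b} f'" "continuous_on {a..b} g'"
  shows "((\<lambda>u. (f' u - (f b - f a) /\<^sub>R (b - a)) \<bullet> (g' u - (g b - g a) /\<^sub>R (b - a)))
     has_integral (integral {a..b} (\<lambda>u. f' u \<bullet> g' u) - ((f b - f a) \<bullet> (g b - g a)) / (b - a))) {a..b}"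
proof -
  define m where "m = (f b - f a) /\<^sub>R (b - a)"
  define n where "n = (g b - g a) /\<^sub>R (b - a)"
  have "(\<lambda>u. f' u \<bullet> g' u) integrable_on {a..b}"
    using assms by (intro integrable_continuous_real continuous_intros)
  then have 1: "((\<lambda>u. f' u \<bullet> g' u) has_integral integral {a..b} (\<lambda>u. f' u \<bullet> g' u)) {a..b}"
    by (rule integrable_integral)
  have 2: "((\<lambda>u. f' u \<bullet> n) has_integral (f b \<bullet> n - f a \<bullet> n)) {a..b}"
    by (rule fundamental_theorem_of_calculus)
      (use assms in \<open>auto intro!: bounded_linear.has_vector_derivative[OF bounded_linear_inner_left] f\<close>)
  have 3: "((\<lambda>u. m \<bullet> g' u) has_integral (m \<bullet> g b - m \<bullet> g a)) {a..b}"
    by (rule fundamental_theorem_of_calculus)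
      (use assms in \<open>auto intro!: bounded_linear.has_vector_derivative[OF bounded_linear_inner_right] g\<close>)
  have 4: "((\<lambda>u. m \<bullet> n) has_integral ((b - a) * (m \<bullet> n))) {a..b}"
    using has_integral_const_real[of "m \<bullet> n" a b] assms by simp
  have "((\<lambda>u. f' u \<bullet> g' u - f' u \<bullet> n - m \<bullet> g' u + m \<bullet> n) has_integral
      integral {a..b} (\<lambda>u. f' u \<bullet> g' u) - (f b \<bullet> n - f a \<bullet> n) - (m \<bullet> g b - m \<bullet> g a) + (b - a) * (m \<bullet> n)) {a..b}"
    by (intro has_integral_add has_integral_diff 1 2 3 4)
  moreover have "(b - a) * (m \<bullet> n) = ((f b - f a) \<bullet> (g b - g a)) / (b - a)"
    "f b \<bullet> n - f a \<bullet> n = ((f b - f a) \<bullet> (g b - g a)) / (b - a)"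
    "m \<bullet> g b - m \<bullet> g a = ((f b - f a) \<bullet> (g b - g a)) / (b - a)"
    using \<open>a < b\<close> by (simp_all add: m_def n_def divide_simps inner_diff_left inner_diff_right)
  moreover have "f' u \<bullet> g' u - f' u \<bullet> n - m \<bullet> g' u + m \<bullet> n = (f' u - m) \<bullet> (g' u - n)" for u
    by (simp add: inner_diff_left inner_diff_right)
  ultimately have "((\<lambda>u. (f' u - m) \<bullet> (g' u - n)) has_integral
      (integral {a..b} (\<lambda>u. f' u \<bullet> g' u) - ((f b - f a) \<bullet> (g b - g a)) / (b - a))) {a..b}"
    by simp
  then show ?thesis by (simp only: m_def n_def)
qed

lemma derivative_minus_mean_bound:
  fixes f :: "real \<Rightarrow> 'a::real_inner"
  assumes "a < b" and u: "u \<in> {a..b}"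
    and f: "\<And>u. u \<in> {a..b} \<Longrightarrow> (f has_vector_derivative f' u) (at u within {a..b})"
    and M: "M-lipschitz_on {a..b} f'"
  shows "norm (f' u - (f b - f a) /\<^sub>R (b - a)) \<le> M * (b - a)"
proof -
  have "0 \<le> M" using M by (rule lipschitz_on_nonneg)
  have *: "norm (f' w - f' u) \<le> M * (b - a)" if "w \<in> {a..b}" for w
  proof -
    have "norm (f' w - f' u) \<le> M * \<bar>w - u\<bar>"
      using lipschitz_onD[OF M that u] by (simp add: dist_norm)
    also have "\<dots> \<le> M * (b - a)"
      using that u \<open>0 \<le> M\<close> by (intro mult_left_mono) auto
    finally show ?thesis .
  qed
  have d: "((\<lambda>w. f w - w *\<^sub>R f' u) has_derivative (\<lambda>x. x *\<^sub>R (f' w - f' u))) (at w within {a..b})"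
    if "w \<in> {a..b}" for w
    using f[OF that] by (auto simp: has_vector_derivative_def algebra_simps intro!: derivative_eq_intros)
  have "norm ((f b - b *\<^sub>R f' u) - (f a - a *\<^sub>R f' u)) \<le> (M * (b - a)) * norm (b - a)"
  proof (rule differentiable_bound[OF convex_closed_interval d])
    fix w assume "w \<in> {a..b}"
    then show "onorm (\<lambda>x. x *\<^sub>R (f' w - f' u)) \<le> M * (b - a)"
      using * by (intro onorm_le) (auto simp: mult.commute intro: mult_left_mono)
  qed (use \<open>a < b\<close> in auto)
  moreover have "(b - a) *\<^sub>R (f' u - (f b - f a) /\<^sub>R (b - a)) = (b - a) *\<^sub>R f' u - (f b - f a)"
    using \<open>a < b\<close> by (simp add: scaleR_right_diff_distrib[of "b - a"])
  moreover have "norm ((f b - b *\<^sub>R f' u) - (f a - a *\<^sub>R f' u))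
      = norm ((b - a) *\<^sub>R f' u - (f b - f a))"
    by (subst norm_minus_commute) (simp add: algebra_simps)
  ultimately have "norm ((b - a) *\<^sub>R (f' u - (f b - f a) /\<^sub>R (b - a))) \<le> (M * (b - a)) * norm (b - a)"
    by simp
  then have "(b - a) * norm (f' u - (f b - f a) /\<^sub>R (b - a)) \<le> (b - a) * (M * (b - a))"
    using \<open>a < b\<close> by (simp add: mult.commute)
  then show ?thesis using \<open>a < b\<close> by simp
qed

text \<open>The error is \<open>b - a\<close> times the covariance of \<open>f'\<close> and \<open>g'\<close>. Each derivative is within \<open>M (b - a)\<close>,
  respectively \<open>N (b - a)\<close>, of its mean, which gives two powers of \<open>b - a\<close>; integration and the factor
  in front give the other two. For the pairs \<open>(r, r)\<close>, \<open>(r, z)\<close> and \<open>(z, z)\<close> this replaces a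
  third-order Taylor expansion.\<close>

lemma chord_inner_approx:
  fixes f g :: "real \<Rightarrow> 'a::real_inner"
  assumes "a \<le> b"
    and f: "\<And>u. u \<in> {a..b} \<Longrightarrow> (f has_vector_derivative f' u) (at u within {a..b})"
    and g: "\<And>u. u \<in> {a..b} \<Longrightarrow> (g has_vector_derivative g' u) (at u within {a..b})"
    and M: "M-lipschitz_on {a..b} f'" and N: "N-lipschitz_on {a..b} g'"
  shows "\<bar>(f b - f a) \<bullet> (g b - g a) - (b - a) * integral {a..b} (\<lambda>u. f' u \<bullet> g' u)\<bar>
    \<le> M * N * (b - a) ^ 4"
proof (cases "a = b")
  case False
  with assms have "a < b" by simp
  have MN: "0 \<le> M" "0 \<le> N" using M N by (auto intro: lipschitz_on_nonneg)
  let ?I = "integral {a..b} (\<lambda>u. f' u \<bullet> g' u) - ((f b - f a) \<bullet> (g b - g a)) / (b - a)"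
  have I: "((\<lambda>u. (f' u - (f b - f a) /\<^sub>R (b - a)) \<bullet> (g' u - (g b - g a) /\<^sub>R (b - a)))
     has_integral ?I) {a..b}"
    using M N by (intro covariance_has_integral \<open>a < b\<close> f g lipschitz_on_continuous_on)
  have "norm ?I \<le> (M * N * (b - a)\<^sup>2) * measure lborel {a..b}"
  proof (rule has_integral_bound_real[OF _ finite.emptyI I], goal_cases)
    case (2 u)
    then have u: "u \<in> {a..b}" by simp
    have "norm ((f' u - (f b - f a) /\<^sub>R (b - a)) \<bullet> (g' u - (g b - g a) /\<^sub>R (b - a)))
       \<le> norm (f' u - (f b - f a) /\<^sub>R (b - a)) * norm (g' u - (g b - g a) /\<^sub>R (b - a))"
      by (simp add: Cauchy_Schwarz_ineq2)
    also have "\<dots> \<le> (M * (b - a)) * (N * (b - a))"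
      using MN \<open>a < b\<close> by (intro mult_mono derivative_minus_mean_bound u f g M N) auto
    finally show "norm ((f' u - (f b - f a) /\<^sub>R (b - a)) \<bullet> (g' u - (g b - g a) /\<^sub>R (b - a)))
      \<le> M * N * (b - a)\<^sup>2" by (simp add: power2_eq_square mult_ac)
  qed (use MN in auto)
  then have "\<bar>?I\<bar> \<le> M * N * (b - a) ^ 3"
    using \<open>a < b\<close> by (simp add: power2_eq_square power3_eq_cube mult_ac)
  then have "(b - a) * \<bar>?I\<bar> \<le> (b - a) * (M * N * (b - a) ^ 3)"
    using \<open>a < b\<close> by (intro mult_left_mono) auto
  moreover have "(b - a) * \<bar>?I\<bar> = \<bar>(b - a) * ?I\<bar>" using \<open>a < b\<close> by (simp add: abs_mult)
  moreover have "(b - a) * ?I = (b - a) * integral {a..b} (\<lambda>u. f' u \<bullet> g' u) - (f b - f a) \<bullet> (g b - g a)"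
    using \<open>a < b\<close> by (simp add: field_simps)
  moreover have "(b - a) * (M * N * (b - a) ^ 3) = M * N * (b - a) ^ 4"
    by (simp add: power_numeral_reduce)
  ultimately show ?thesis by (simp add: abs_minus_commute)
qed simp

text \<open>The Cauchy-Schwarz inequality for \<open>v\<close> and \<open>1\<close>, obtained as the nonnegativity of the variance of \<open>v\<close>.\<close>

lemma increment_sq_le:
  fixes F :: "real \<Rightarrow> real"
  assumes "a \<le> b"
    and F: "\<And>u. u \<in> {a..b} \<Longrightarrow> (F has_vector_derivative v u) (at u within {a..b})"
    and v: "continuous_on {a..b} v"
  shows "(F b - F a)\<^sup>2 \<le> (b - a) * integral {a..b} (\<lambda>u. (v u)\<^sup>2)"
proof (cases "a = b")
  case False
  with assms have "a < b" by simp
  have "0 \<le> integral {a..b} (\<lambda>u. v u \<bullet> v u) - ((F b - F a) \<bullet> (F b - F a)) / (b - a)"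
    by (rule has_integral_nonneg[OF covariance_has_integral[OF \<open>a < b\<close> F F v v]]) auto
  then show ?thesis using \<open>a < b\<close> by (simp add: field_simps power2_eq_square)
qed simp

text \<open>Here \<open>F b - F a\<close> is the length of the graph curve \<open>u \<mapsto> (u, \<epsilon> z u)\<close>. The lower bound
  compares it with its chord. The upper bound is the Cauchy-Schwarz inequality, followed by the
  replacement of the mean of \<open>\<bar>z'\<bar>\<^sup>2\<close> by the squared chord of \<open>z\<close>. The factor \<open>\<epsilon>\<^sup>2\<close> in front of
  the fourth-order error is what makes the bound useful uniformly in \<open>\<epsilon>\<close>.\<close>

lemma graph_length_sq_bounds:
  fixes z :: "real \<Rightarrow> 'a::real_inner" and \<epsilon> :: real
  assumes "a \<le> b"
    and z: "\<And>u. u \<in> {a..b} \<Longrightarrow> (z has_vector_derivative z' u) (at u within {a..b})"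
    and N: "N-lipschitz_on {a..b} z'"
    and F: "\<And>u. u \<in> {a..b} \<Longrightarrow>
        (F has_vector_derivative sqrt (1 + \<epsilon>\<^sup>2 * (norm (z' u))\<^sup>2)) (at u within {a..b})"
  shows "(b - a)\<^sup>2 + \<epsilon>\<^sup>2 * (norm (z b - z a))\<^sup>2 \<le> (F b - F a)\<^sup>2"
    and "(F b - F a)\<^sup>2 \<le> (b - a)\<^sup>2 + \<epsilon>\<^sup>2 * (norm (z b - z a))\<^sup>2 + \<epsilon>\<^sup>2 * (N\<^sup>2 * (b - a) ^ 4)"
proof -
  have c: "continuous_on {a..b} z'" using N by (rule lipschitz_on_continuous_on)
  let ?c = "\<lambda>u. (u, \<epsilon> *\<^sub>R z u)"
  show "(b - a)\<^sup>2 + \<epsilon>\<^sup>2 * (norm (z b - z a))\<^sup>2 \<le> (F b - F a)\<^sup>2"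
  proof (cases "a = b")
    case False
    with assms have ab: "a < b" by simp
    have d: "(?c has_vector_derivative (1, \<epsilon> *\<^sub>R z' u)) (at u within {a..b})" if "u \<in> {a..b}" for u
      using z[OF that] unfolding has_vector_derivative_def
      by (auto intro!: derivative_eq_intros simp: fun_eq_iff algebra_simps)
    have "norm (?c b - ?c a) \<le> F b - F a"
    proof (rule differentiable_bound_general[OF ab])
      show "continuous_on {a..b} ?c"
        unfolding continuous_on_eq_continuous_within
        by (intro ballI has_vector_derivative_continuous) (rule d)
      show "continuous_on {a..b} F"
        unfolding continuous_on_eq_continuous_within
        by (intro ballI has_vector_derivative_continuous) (rule F)
      fix u assume u: "a < u" "u < b"
      then have w: "at u within {a..b} = at u" "u \<in> {a..b}"
        using at_within_Icc_at[of a u b] by auto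
      show "(?c has_vector_derivative (1, \<epsilon> *\<^sub>R z' u)) (at u)" using d[OF w(2)] w(1) by simp
      show "(F has_vector_derivative sqrt (1 + \<epsilon>\<^sup>2 * (norm (z' u))\<^sup>2)) (at u)" using F[OF w(2)] w(1) by simp
      show "norm (1::real, \<epsilon> *\<^sub>R z' u) \<le> sqrt (1 + \<epsilon>\<^sup>2 * (norm (z' u))\<^sup>2)"
        by (simp add: norm_Pair power_mult_distrib)
    qed
    then have "(norm (?c b - ?c a))\<^sup>2 \<le> (F b - F a)\<^sup>2" by (intro power_mono) auto
    moreover have "?c b - ?c a = (b - a, \<epsilon> *\<^sub>R (z b - z a))" by (simp add: algebra_simps)
    ultimately show ?thesis by (simp add: norm_Pair power_mult_distrib)
  qed simp
  have cv: "continuous_on {a..b} (\<lambda>u. sqrt (1 + \<epsilon>\<^sup>2 * (norm (z' u))\<^sup>2))"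
    using c by (intro continuous_intros)
  have "(F b - F a)\<^sup>2 \<le> (b - a) * integral {a..b} (\<lambda>u. (sqrt (1 + \<epsilon>\<^sup>2 * (norm (z' u))\<^sup>2))\<^sup>2)"
    by (rule increment_sq_le[OF \<open>a \<le> b\<close> F cv])
  also have "(\<lambda>u. (sqrt (1 + \<epsilon>\<^sup>2 * (norm (z' u))\<^sup>2))\<^sup>2) = (\<lambda>u. 1 + \<epsilon>\<^sup>2 * (z' u \<bullet> z' u))"
    by (simp add: power2_norm_eq_inner add_nonneg_nonneg)
  also have "integral {a..b} \<dots> = (b - a) + \<epsilon>\<^sup>2 * integral {a..b} (\<lambda>u. z' u \<bullet> z' u)"
  proof -
    have "(\<lambda>u. z' u \<bullet> z' u) integrable_on {a..b}"
      using c by (intro integrable_continuous_real continuous_intros)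
    then have "((\<lambda>u. 1 + \<epsilon>\<^sup>2 * (z' u \<bullet> z' u)) has_integral (b - a) + \<epsilon>\<^sup>2 * integral {a..b} (\<lambda>u. z' u \<bullet> z' u)) {a..b}"
      using has_integral_const_real[of "1::real" a b] \<open>a \<le> b\<close>
      by (intro has_integral_add has_integral_mult_right) (auto simp: integrable_integral)
    then show ?thesis by (rule integral_unique)
  qed
  also have "(b - a) * ((b - a) + \<epsilon>\<^sup>2 * integral {a..b} (\<lambda>u. z' u \<bullet> z' u))
      = (b - a)\<^sup>2 + \<epsilon>\<^sup>2 * ((b - a) * integral {a..b} (\<lambda>u. z' u \<bullet> z' u))"
    by (simp add: power2_eq_square algebra_simps)
  also have "\<dots> \<le> (b - a)\<^sup>2 + \<epsilon>\<^sup>2 * ((norm (z b - z a))\<^sup>2 + N\<^sup>2 * (b - a) ^ 4)"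
  proof -
    have "(b - a) * integral {a..b} (\<lambda>u. z' u \<bullet> z' u) \<le> (norm (z b - z a))\<^sup>2 + N\<^sup>2 * (b - a) ^ 4"
      using chord_inner_approx[OF \<open>a \<le> b\<close> z z N N]
      by (simp add: power2_norm_eq_inner power2_eq_square[of N])
    then show ?thesis by (intro add_left_mono mult_left_mono) auto
  qed
  finally show "(F b - F a)\<^sup>2 \<le> (b - a)\<^sup>2 + \<epsilon>\<^sup>2 * (norm (z b - z a))\<^sup>2 + \<epsilon>\<^sup>2 * (N\<^sup>2 * (b - a) ^ 4)"
    by (simp add: algebra_simps)
qed

section \<open>Expansion of the normalized energy density\<close>

text \<open>The energy density in rescaled variables: \<open>H\<close> is the squared distance along the curve,
  \<open>H (\<alpha> + 2 \<epsilon> \<beta> H + \<epsilon>\<^sup>2 \<gamma>)\<close> the squared chord, \<open>H (1 + \<epsilon>\<^sup>2 \<gamma> + \<epsilon>\<^sup>2 \<eta> H)\<close> the squared distance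
  along the bent curve, and \<open>1 + \<epsilon>\<^sup>2 \<nu>\<close> the product of the speeds. The equation \<open>\<alpha> + \<kappa> H = 1\<close> says
  that \<open>H\<^sup>2 \<kappa>\<close> is the excess of \<open>H\<close> over the squared chord of the original curve. No power of \<open>H\<close> is left in a
  denominator, so the remainder is \<open>\<epsilon>\<^sup>2\<close> times a polynomial on a compact box, over a denominator
  bounded away from zero.\<close>

lemma energy_density_expansion:
  fixes k C :: real
  assumes "0 < k" "1 \<le> C"
  obtains e0 K where "0 < e0" "\<And>\<epsilon> \<alpha> \<beta> \<gamma> \<eta> \<kappa> \<nu> H.
     \<bar>\<epsilon>\<bar> \<le> e0 \<Longrightarrow> k \<le> \<alpha> \<Longrightarrow> \<bar>\<alpha>\<bar> \<le> C \<Longrightarrow> \<bar>\<beta>\<bar> \<le> C \<Longrightarrow> 0 \<le> \<gamma> \<Longrightarrow> \<gamma> \<le> C \<Longrightarrow> 0 \<le> \<eta> \<Longrightarrow> \<eta> \<le> C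
     \<Longrightarrow> \<bar>\<kappa>\<bar> \<le> C \<Longrightarrow> 0 \<le> \<nu> \<Longrightarrow> \<nu> \<le> C \<Longrightarrow> 0 \<le> H \<Longrightarrow> H \<le> C \<Longrightarrow> \<alpha> + \<kappa> * H = 1 \<Longrightarrow>
     0 < \<alpha> + 2 * \<epsilon> * \<beta> * H + \<epsilon>\<^sup>2 * \<gamma> \<and>
     \<bar>(1 + \<epsilon>\<^sup>2 * \<nu>) * (\<kappa> - 2 * \<epsilon> * \<beta> + \<epsilon>\<^sup>2 * \<eta>)
        / ((\<alpha> + 2 * \<epsilon> * \<beta> * H + \<epsilon>\<^sup>2 * \<gamma>) * (1 + \<epsilon>\<^sup>2 * \<gamma> + \<epsilon>\<^sup>2 * \<eta> * H))
       - \<kappa> / \<alpha> + 2 * \<epsilon> * \<beta> / \<alpha>\<^sup>2\<bar> \<le> K * \<epsilon>\<^sup>2"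
proof -
  \<comment> \<open>This choice gives \<open>2 \<bar>\<epsilon> \<beta> H\<bar> \<le> k / 2\<close>, so half of the lower bound for \<open>\<alpha>\<close> survives.\<close>
  define e0 where "e0 = min 1 (k / (4 * C\<^sup>2))"
  have "0 < e0" using assms by (simp add: e0_def)
  \<comment> \<open>The quotient of the numerator of the remainder, over the common denominator, by \<open>\<epsilon>\<^sup>2\<close>.\<close>
  define R :: "real \<times> real \<times> real \<times> real \<times> real \<times> real \<times> real \<times> real \<Rightarrow> real" where
    "R = (\<lambda>(\<epsilon>, \<alpha>, \<beta>, \<gamma>, \<eta>, \<kappa>, \<nu>, H).
      (\<nu> * (\<kappa> - 2 * \<epsilon> * \<beta> + \<epsilon>\<^sup>2 * \<eta>) * \<alpha>\<^sup>2 + \<eta> * \<alpha>\<^sup>2 + 4 * \<beta>\<^sup>2 * H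
        - (\<kappa> * \<alpha> - 2 * \<epsilon> * \<beta>) * (\<gamma> + (\<gamma> + \<eta> * H) * (\<alpha> + 2 * \<epsilon> * \<beta> * H + \<epsilon>\<^sup>2 * \<gamma>))))"
  let ?B = "{-1..1} \<times> {-C..C} \<times> {-C..C} \<times> {0..C} \<times> {0..C} \<times> {-C..C} \<times> {0..C} \<times> {0..C}"
  have "compact (R ` ?B)"
    unfolding R_def case_prod_unfold
    by (intro compact_continuous_image compact_Times compact_Icc continuous_intros)
  then obtain K0 where K0: "\<And>x. x \<in> ?B \<Longrightarrow> \<bar>R x\<bar> \<le> K0"
    using compact_imp_bounded[of "R ` ?B"] by (metis bounded_iff imageI real_norm_def)
  define K where "K = K0 / (k / 2 * k\<^sup>2)"
  show thesis
  proof (rule that[OF \<open>0 < e0\<close>, of K])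
    fix \<epsilon> \<alpha> \<beta> \<gamma> \<eta> \<kappa> \<nu> H :: real
    assume A: "\<bar>\<epsilon>\<bar> \<le> e0" "k \<le> \<alpha>" "\<bar>\<alpha>\<bar> \<le> C" "\<bar>\<beta>\<bar> \<le> C" "0 \<le> \<gamma>" "\<gamma> \<le> C" "0 \<le> \<eta>" "\<eta> \<le> C"
      "\<bar>\<kappa>\<bar> \<le> C" "0 \<le> \<nu>" "\<nu> \<le> C" "0 \<le> H" "H \<le> C" "\<alpha> + \<kappa> * H = 1"
    define p where "p = \<alpha> + 2 * \<epsilon> * \<beta> * H + \<epsilon>\<^sup>2 * \<gamma>"
    define q where "q = 1 + \<epsilon>\<^sup>2 * \<gamma> + \<epsilon>\<^sup>2 * \<eta> * H"
    define u where "u = \<kappa> - 2 * \<epsilon> * \<beta> + \<epsilon>\<^sup>2 * \<eta>"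
    have "\<bar>\<epsilon> * \<beta> * H\<bar> \<le> e0 * C * C"
      using A assms by (auto simp: abs_mult intro!: mult_mono)
    also have "\<dots> \<le> k / (4 * C\<^sup>2) * C * C"
      using assms by (intro mult_right_mono) (auto simp: e0_def)
    also have "\<dots> = k / 4" using assms by (simp add: power2_eq_square)
    finally have "k / 2 \<le> \<alpha> + 2 * \<epsilon> * \<beta> * H" using A by linarith
    then have p: "k / 2 \<le> p" using A(5) by (simp add: p_def add_increasing2)
    have q: "1 \<le> q" using A by (simp add: q_def)
    have Rb: "\<bar>R (\<epsilon>, \<alpha>, \<beta>, \<gamma>, \<eta>, \<kappa>, \<nu>, H)\<bar> \<le> K0"
      using A by (intro K0) (auto simp: e0_def)
    \<comment> \<open>The terms of order one in \<open>\<epsilon>\<close> have the factor \<open>\<alpha> + \<kappa> * H - 1\<close>.\<close>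
    have pq: "p * q = \<alpha> + 2 * \<epsilon> * \<beta> * H + \<epsilon>\<^sup>2 * (\<gamma> + (\<gamma> + \<eta> * H) * p)"
      by (simp add: q_def p_def algebra_simps)
    have "(1 + \<epsilon>\<^sup>2 * \<nu>) * u * \<alpha>\<^sup>2 - (\<kappa> * \<alpha> - 2 * \<epsilon> * \<beta>) * (\<alpha> + 2 * \<epsilon> * \<beta> * H + \<epsilon>\<^sup>2 * X)
        = \<epsilon>\<^sup>2 * (\<nu> * u * \<alpha>\<^sup>2 + \<eta> * \<alpha>\<^sup>2 + 4 * \<beta>\<^sup>2 * H - (\<kappa> * \<alpha> - 2 * \<epsilon> * \<beta>) * X)
          - 2 * \<epsilon> * \<alpha> * \<beta> * (\<alpha> + \<kappa> * H - 1)" for X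
      unfolding u_def by (simp add: algebra_simps power2_eq_square)
    from this[of "\<gamma> + (\<gamma> + \<eta> * H) * p"]
    have num: "(1 + \<epsilon>\<^sup>2 * \<nu>) * u * \<alpha>\<^sup>2 - (\<kappa> * \<alpha> - 2 * \<epsilon> * \<beta>) * (p * q)
        = \<epsilon>\<^sup>2 * R (\<epsilon>, \<alpha>, \<beta>, \<gamma>, \<eta>, \<kappa>, \<nu>, H)" unfolding pq R_def prod.case p_def[symmetric] u_def[symmetric] A(14) by simp
    have nz: "p \<noteq> 0" "q \<noteq> 0" "\<alpha> \<noteq> 0" using p q A assms by auto
    have "N / P - \<kappa> / \<alpha> + w / \<alpha>\<^sup>2 = (N * \<alpha>\<^sup>2 - (\<kappa> * \<alpha> - w) * P) / (P * \<alpha>\<^sup>2)"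
      if "P \<noteq> 0" for N P w
      using nz that by (simp add: field_simps power2_eq_square)
    from this[of "p * q" "(1 + \<epsilon>\<^sup>2 * \<nu>) * u" "2 * \<epsilon> * \<beta>"] nz
    have "(1 + \<epsilon>\<^sup>2 * \<nu>) * u / (p * q) - \<kappa> / \<alpha> + 2 * \<epsilon> * \<beta> / \<alpha>\<^sup>2
        = R (\<epsilon>, \<alpha>, \<beta>, \<gamma>, \<eta>, \<kappa>, \<nu>, H) / (p * q * \<alpha>\<^sup>2) * \<epsilon>\<^sup>2"
      unfolding num by simp
    also have "\<bar>\<dots>\<bar> = \<bar>R (\<epsilon>, \<alpha>, \<beta>, \<gamma>, \<eta>, \<kappa>, \<nu>, H)\<bar> / (p * q * \<alpha>\<^sup>2) * \<epsilon>\<^sup>2"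
      using p q assms by (simp add: abs_mult)
    also have "\<dots> \<le> K * \<epsilon>\<^sup>2"
      unfolding K_def
    proof (intro mult_right_mono frac_le Rb)
      have "k / 2 * 1 * k\<^sup>2 \<le> p * q * \<alpha>\<^sup>2"
        using p q A assms by (intro mult_mono power_mono) auto
      then show "k / 2 * k\<^sup>2 \<le> p * q * \<alpha>\<^sup>2" by simp
    qed (use Rb assms in auto)
    finally have "\<bar>(1 + \<epsilon>\<^sup>2 * \<nu>) * u / (p * q) - \<kappa> / \<alpha> + 2 * \<epsilon> * \<beta> / \<alpha>\<^sup>2\<bar> \<le> K * \<epsilon>\<^sup>2" .
    moreover have "0 < p" using p assms by simp
    ultimately show "0 < \<alpha> + 2 * \<epsilon> * \<beta> * H + \<epsilon>\<^sup>2 * \<gamma> \<and>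
     \<bar>(1 + \<epsilon>\<^sup>2 * \<nu>) * (\<kappa> - 2 * \<epsilon> * \<beta> + \<epsilon>\<^sup>2 * \<eta>)
        / ((\<alpha> + 2 * \<epsilon> * \<beta> * H + \<epsilon>\<^sup>2 * \<gamma>) * (1 + \<epsilon>\<^sup>2 * \<gamma> + \<epsilon>\<^sup>2 * \<eta> * H))
       - \<kappa> / \<alpha> + 2 * \<epsilon> * \<beta> / \<alpha>\<^sup>2\<bar> \<le> K * \<epsilon>\<^sup>2"
      unfolding p_def q_def u_def by (rule conjI[rotated])
  qed
qed

section \<open>Differentiation under the integral sign\<close>

lemma set_integral_has_real_derivative_at_0:
  fixes f :: "real \<Rightarrow> 'a \<Rightarrow> real"
  assumes A: "A \<in> sets M" "emeasure M A < \<infinity>" and "0 < e0"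
    and f: "\<And>\<epsilon>. \<bar>\<epsilon>\<bar> \<le> e0 \<Longrightarrow> set_integrable M A (f \<epsilon>)" and g: "set_integrable M A g"
    and K: "\<And>\<epsilon> x. \<bar>\<epsilon>\<bar> \<le> e0 \<Longrightarrow> x \<in> A \<Longrightarrow> \<bar>f \<epsilon> x - f 0 x - \<epsilon> * g x\<bar> \<le> K * \<epsilon>\<^sup>2"
  shows "((\<lambda>\<epsilon>. set_lebesgue_integral M A (f \<epsilon>)) has_real_derivative set_lebesgue_integral M A g) (at 0)"
proof -
  let ?E = "\<lambda>\<epsilon>. set_lebesgue_integral M A (f \<epsilon>)" and ?D = "set_lebesgue_integral M A g"
  have f0: "set_integrable M A (f 0)" using f[of 0] \<open>0 < e0\<close> by simp
  have c: "set_integrable M A (\<lambda>_. c :: real)" for c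
    using A unfolding set_integrable_def by (intro integrableI_bounded_set_indicator[where B = "\<bar>c\<bar>"]) auto
  have E: "\<bar>?E \<epsilon> - ?E 0 - \<epsilon> * ?D\<bar> \<le> (K * measure M A) * \<epsilon>\<^sup>2" if "\<bar>\<epsilon>\<bar> \<le> e0" for \<epsilon>
  proof -
    let ?R = "\<lambda>x. f \<epsilon> x - f 0 x - \<epsilon> * g x"
    have R: "set_integrable M A ?R"
      using f[OF that] f0 g by simp
    have eq: "?E \<epsilon> - ?E 0 - \<epsilon> * ?D = set_lebesgue_integral M A ?R"
      using f[OF that] f0 g by simp
    have "\<bar>set_lebesgue_integral M A ?R\<bar> \<le> set_lebesgue_integral M A (\<lambda>x. \<bar>?R x\<bar>)"
      using set_integral_norm_bound[OF R] by simp
    also have "\<dots> \<le> set_lebesgue_integral M A (\<lambda>x. K * \<epsilon>\<^sup>2)"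
      using K that by (intro set_integral_mono set_integrable_abs R c) auto
    also have "\<dots> = (K * measure M A) * \<epsilon>\<^sup>2"
      using A by (simp add: set_lebesgue_integral_def)
    finally show ?thesis unfolding eq .
  qed
  have "((\<lambda>h. (?E (0 + h) - ?E 0) / h - ?D) \<longlongrightarrow> 0) (at 0)"
  proof (rule Lim_null_comparison)
    have "\<forall>\<^sub>F h in at 0. dist h 0 < e0 \<and> h \<noteq> 0"
      using \<open>0 < e0\<close> by (auto simp: eventually_at)
    then show "\<forall>\<^sub>F h in at 0. norm ((?E (0 + h) - ?E 0) / h - ?D) \<le> (K * measure M A) * \<bar>h\<bar>"
    proof eventually_elim
      case (elim h)
      then have "\<bar>?E h - ?E 0 - h * ?D\<bar> / \<bar>h\<bar> \<le> (K * measure M A) * h\<^sup>2 / \<bar>h\<bar>"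
        by (intro divide_right_mono E) (auto simp: dist_norm)
      also have "\<dots> = (K * measure M A) * \<bar>h\<bar>"
        using elim by (simp add: field_simps power2_eq_square abs_mult_self_eq)
      also have "\<bar>?E h - ?E 0 - h * ?D\<bar> / \<bar>h\<bar> = \<bar>(?E h - ?E 0 - h * ?D) / h\<bar>" by simp
      also have "(?E h - ?E 0 - h * ?D) / h = (?E h - ?E 0) / h - ?D"
        using elim by (simp add: diff_divide_distrib)
      finally show ?case by simp
    qed
    show "((\<lambda>h. (K * measure M A) * \<bar>h\<bar>) \<longlongrightarrow> 0) (at 0)"
      by (intro tendsto_mult_right_zero tendsto_rabs_zero tendsto_ident_at)
  qed
  then show ?thesis unfolding DERIV_def by (rule LIM_zero_cancel)
qed

section \<open>Smooth curves and their bendings\<close>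

lemma smooth_velocity: "smooth f \<Longrightarrow> smooth (velocity f)"
  unfolding smooth_def by (metis funpow_Suc_right o_apply)

lemma smooth_has_velocity: "smooth f \<Longrightarrow> (f has_vector_derivative velocity f s) (at s within A)"
  unfolding smooth_def
  by (metis funpow_0 vector_derivative_works has_vector_derivative_at_within)

lemma smooth_continuous_on: "smooth f \<Longrightarrow> continuous_on A f"
  unfolding continuous_on_eq_continuous_within
  by (intro ballI has_vector_derivative_continuous) (rule smooth_has_velocity)

lemma smooth_lipschitz:
  assumes "smooth f"
  obtains M where "M-lipschitz_on {a..b} f"
proof -
  have "bounded (velocity f ` {a..b})"
    by (intro compact_imp_bounded compact_continuous_image smooth_continuous_on
        smooth_velocity assms compact_Icc)
  then obtain M where M: "0 < M" "\<And>u. u \<in> {a..b} \<Longrightarrow> norm (velocity f u) \<le> M"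
    by (auto simp: bounded_pos)
  have "M-lipschitz_on {a..b} f"
  proof (rule bounded_derivative_imp_lipschitz)
    show "(f has_derivative (\<lambda>x. x *\<^sub>R velocity f u)) (at u within {a..b})" for u
      using smooth_has_velocity[OF assms] by (simp add: has_vector_derivative_def)
    show "onorm (\<lambda>x. x *\<^sub>R velocity f u) \<le> M" if "u \<in> {a..b}" for u
      using M(2)[OF that] by (intro onorm_le) (auto simp: mult.commute[of M] intro: mult_left_mono)
  qed (use M in auto)
  then show thesis by (rule that)
qed

lemma velocity_bending:
  assumes "smooth r" "smooth z"
  shows "velocity (bending r z \<epsilon>) s = velocity r s + \<epsilon> *\<^sub>R velocity z s"
  unfolding bending_def
  by (intro vector_derivative_at has_vector_derivative_add smooth_has_velocity assms
      bounded_linear.has_vector_derivative[OF bounded_linear_scaleR_right])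

text \<open>The orthogonality of \<open>r'\<close> and \<open>z'\<close> enters here: the speed has no term linear in \<open>\<epsilon>\<close>.\<close>

lemma speed_bending:
  assumes "arc_length_knot L r" "infinitesimal_bending_field L r z"
  shows "norm (velocity (bending r z \<epsilon>) s) = sqrt (1 + \<epsilon>\<^sup>2 * (norm (velocity z s))\<^sup>2)"
proof -
  have "smooth r" "smooth z" "norm (velocity r s) = 1" "velocity r s \<bullet> velocity z s = 0"
    using assms by (auto simp: arc_length_knot_def infinitesimal_bending_field_def smooth_on_circle_def)
  then show ?thesis
    by (simp add: velocity_bending norm_eq_sqrt_inner inner_add_left inner_add_right inner_commute
        power2_eq_square add_nonneg_nonneg)
qed

lemma arc_length_antiderivative:
  assumes "continuous_on UNIV (velocity \<gamma>)"
  obtains F where "\<And>u. (F has_vector_derivative norm (velocity \<gamma> u)) (at u)"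
    "\<And>a b. a \<le> b \<Longrightarrow> arc_length \<gamma> a b = F b - F a"
proof -
  have c: "isCont (\<lambda>u. norm (velocity \<gamma> u)) u" for u
    using assms by (intro continuous_intros) (simp add: continuous_on_eq_continuous_at)
  obtain F where F: "\<And>u. (F has_vector_derivative norm (velocity \<gamma> u)) (at u)"
    using einterval_antiderivative[of "-\<infinity>" \<infinity> "\<lambda>u. norm (velocity \<gamma> u)"] c by auto
  show thesis
  proof (rule that[OF F])
    fix a b :: real assume "a \<le> b"
    then show "arc_length \<gamma> a b = F b - F a"
      unfolding arc_length_def set_lebesgue_integral_def
    proof (rule integral_FTC_atLeastAtMost)
      show "(F has_vector_derivative norm (velocity \<gamma> u)) (at u within {a..b})" for u
        by (rule has_vector_derivative_at_within[OF F])
      show "continuous_on {a..b} (\<lambda>u. norm (velocity \<gamma> u))"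
        by (rule continuous_at_imp_continuous_on) (simp add: c)
    qed
  qed
qed

text \<open>The unit speed makes the mean of \<open>r' \<bullet> r'\<close> equal
  to one, and the bending condition makes the mean of \<open>r' \<bullet> z'\<close> vanish; this is why the chord
  products of \<open>r\<close> have errors of fourth order.\<close>

lemma arc_estimates:
  assumes K: "arc_length_knot L r" and B: "infinitesimal_bending_field L r z"
  obtains C where "1 \<le> C"
    "\<And>x y. a \<le> x \<Longrightarrow> x \<le> y \<Longrightarrow> y \<le> b \<Longrightarrow> \<bar>(norm (r y - r x))\<^sup>2 - (y - x)\<^sup>2\<bar> \<le> C * (y - x) ^ 4"
    "\<And>x y. a \<le> x \<Longrightarrow> x \<le> y \<Longrightarrow> y \<le> b \<Longrightarrow> \<bar>(r y - r x) \<bullet> (z y - z x)\<bar> \<le> C * (y - x) ^ 4"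
    "\<And>x y. a \<le> x \<Longrightarrow> x \<le> y \<Longrightarrow> y \<le> b \<Longrightarrow> (norm (z y - z x))\<^sup>2 \<le> C * (y - x)\<^sup>2"
    "\<And>x y \<epsilon>. a \<le> x \<Longrightarrow> x \<le> y \<Longrightarrow> y \<le> b \<Longrightarrow>
       (y - x)\<^sup>2 + \<epsilon>\<^sup>2 * (norm (z y - z x))\<^sup>2 \<le> (arc_length (bending r z \<epsilon>) x y)\<^sup>2"
    "\<And>x y \<epsilon>. a \<le> x \<Longrightarrow> x \<le> y \<Longrightarrow> y \<le> b \<Longrightarrow>
       (arc_length (bending r z \<epsilon>) x y)\<^sup>2
         \<le> (y - x)\<^sup>2 + \<epsilon>\<^sup>2 * (norm (z y - z x))\<^sup>2 + \<epsilon>\<^sup>2 * (C * (y - x) ^ 4)"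
    "\<And>u. a \<le> u \<Longrightarrow> u \<le> b \<Longrightarrow> (norm (velocity z u))\<^sup>2 \<le> C"
proof -
  have r: "smooth r" and z: "smooth z"
    and unit: "\<And>s. velocity r s \<bullet> velocity r s = 1" and orth: "\<And>s. velocity r s \<bullet> velocity z s = 0"
    using K B by (auto simp: arc_length_knot_def infinitesimal_bending_field_def smooth_on_circle_def
        dot_square_norm)
  obtain M where M: "M-lipschitz_on {a..b} (velocity r)"
    using smooth_lipschitz[OF smooth_velocity[OF r]] by blast
  obtain N where N: "N-lipschitz_on {a..b} (velocity z)"
    using smooth_lipschitz[OF smooth_velocity[OF z]] by blast
  obtain Z where Z: "Z-lipschitz_on {a..b} z"
    using smooth_lipschitz[OF z] by blast
  have "bounded (velocity z ` {a..b})"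
    by (intro compact_imp_bounded compact_continuous_image smooth_continuous_on
        smooth_velocity z compact_Icc)
  then obtain V where V: "\<forall>v\<in>velocity z ` {a..b}. norm v \<le> V"
    unfolding bounded_iff ..
  have nn: "0 \<le> M" "0 \<le> N" "0 \<le> Z" using M N Z by (auto intro: lipschitz_on_nonneg)
  define C where "C = 1 + M * M + M * N + Z\<^sup>2 + N\<^sup>2 + V\<^sup>2"
  have C: "1 \<le> C" "M * M \<le> C" "M * N \<le> C" "Z\<^sup>2 \<le> C" "N\<^sup>2 \<le> C" "V\<^sup>2 \<le> C"
    using nn mult_nonneg_nonneg[of M N] mult_nonneg_nonneg[of M M] zero_le_power2[of Z]
      zero_le_power2[of N] zero_le_power2[of V] unfolding C_def by linarith+
  show thesis
  proof (rule that[OF C(1)])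
    fix x y :: real and \<epsilon> :: real assume xy: "a \<le> x" "x \<le> y" "y \<le> b"
    then have sub: "{x..y} \<subseteq> {a..b}" by auto
    note M' = lipschitz_on_subset[OF M sub] and N' = lipschitz_on_subset[OF N sub]
    note dr = smooth_has_velocity[OF r] and dz = smooth_has_velocity[OF z]
    have "\<bar>(norm (r y - r x))\<^sup>2 - (y - x)\<^sup>2\<bar> \<le> M * M * (y - x) ^ 4"
      using chord_inner_approx[OF xy(2) dr dr M' M'] xy
      by (simp add: unit power2_norm_eq_inner power2_eq_square[of "y - x"])
    also have "\<dots> \<le> C * (y - x) ^ 4" by (intro mult_right_mono C) auto
    finally show "\<bar>(norm (r y - r x))\<^sup>2 - (y - x)\<^sup>2\<bar> \<le> C * (y - x) ^ 4" .
    have "\<bar>(r y - r x) \<bullet> (z y - z x)\<bar> \<le> M * N * (y - x) ^ 4"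
      using chord_inner_approx[OF xy(2) dr dz M' N'] by (simp add: orth)
    also have "\<dots> \<le> C * (y - x) ^ 4" by (intro mult_right_mono C) auto
    finally show "\<bar>(r y - r x) \<bullet> (z y - z x)\<bar> \<le> C * (y - x) ^ 4" .
    have "norm (z y - z x) \<le> Z * (y - x)"
      using lipschitz_onD[OF Z, of y x] xy by (auto simp: dist_norm)
    then have "(norm (z y - z x))\<^sup>2 \<le> (Z * (y - x))\<^sup>2" by (intro power_mono) auto
    also have "\<dots> \<le> C * (y - x)\<^sup>2"
      unfolding power_mult_distrib by (intro mult_right_mono C) auto
    finally show "(norm (z y - z x))\<^sup>2 \<le> C * (y - x)\<^sup>2" .
    have vb: "velocity (bending r z \<epsilon>) = (\<lambda>s. velocity r s + \<epsilon> *\<^sub>R velocity z s)"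
      using velocity_bending[OF r z] by auto
    have "continuous_on UNIV (velocity (bending r z \<epsilon>))"
      unfolding vb by (intro continuous_intros smooth_continuous_on smooth_velocity r z)
    then obtain F where F: "\<And>u. (F has_vector_derivative norm (velocity (bending r z \<epsilon>) u)) (at u)"
      and len: "\<And>a b. a \<le> b \<Longrightarrow> arc_length (bending r z \<epsilon>) a b = F b - F a"
      by (rule arc_length_antiderivative) blast
    have F': "(F has_vector_derivative sqrt (1 + \<epsilon>\<^sup>2 * (norm (velocity z u))\<^sup>2)) (at u within {x..y})" for u
      using has_vector_derivative_at_within[OF F] by (simp only: speed_bending[OF K B])
    note G = graph_length_sq_bounds[OF xy(2) dz N' F', folded len[OF xy(2)]]
    show "(y - x)\<^sup>2 + \<epsilon>\<^sup>2 * (norm (z y - z x))\<^sup>2 \<le> (arc_length (bending r z \<epsilon>) x y)\<^sup>2"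
      by (rule G(1))
    have "N\<^sup>2 * (y - x) ^ 4 \<le> C * (y - x) ^ 4" by (intro mult_right_mono C) auto
    then have "\<epsilon>\<^sup>2 * (N\<^sup>2 * (y - x) ^ 4) \<le> \<epsilon>\<^sup>2 * (C * (y - x) ^ 4)" by (intro mult_left_mono) auto
    then show "(arc_length (bending r z \<epsilon>) x y)\<^sup>2
         \<le> (y - x)\<^sup>2 + \<epsilon>\<^sup>2 * (norm (z y - z x))\<^sup>2 + \<epsilon>\<^sup>2 * (C * (y - x) ^ 4)"
      using G(2) by linarith
  next
    fix u assume "a \<le> u" "u \<le> b"
    then have "(norm (velocity z u))\<^sup>2 \<le> V\<^sup>2" using V by (intro power_mono) auto
    then show "(norm (velocity z u))\<^sup>2 \<le> C" using C by linarith
  qed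
qed

section \<open>Estimates in terms of the distance on the circle\<close>

definition circle_dist :: "real \<Rightarrow> real \<Rightarrow> real \<Rightarrow> real" where
  "circle_dist L s t = min \<bar>s - t\<bar> (L - \<bar>s - t\<bar>)"

text \<open>Both arcs joining two points have the same chords, by periodicity, and both satisfy the
  estimates for arcs. The shortest arc of the bent curve need not come from the shortest arc of the
  original one, but the bounds are monotone in the length of the arc, so they pass to the minimum of
  the two lengths. The interval \<open>{0..2 * L}\<close> contains the parameters of both arcs.\<close>

lemma circle_estimates:
  assumes K: "arc_length_knot L r" and B: "infinitesimal_bending_field L r z"
  obtains C where "1 \<le> C"
    "\<And>s t. s \<in> {0..L} \<Longrightarrow> t \<in> {0..L} \<Longrightarrow>
       \<bar>(norm (r s - r t))\<^sup>2 - (circle_dist L s t)\<^sup>2\<bar> \<le> C * circle_dist L s t ^ 4"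
    "\<And>s t. s \<in> {0..L} \<Longrightarrow> t \<in> {0..L} \<Longrightarrow>
       \<bar>(r s - r t) \<bullet> (z s - z t)\<bar> \<le> C * circle_dist L s t ^ 4"
    "\<And>s t. s \<in> {0..L} \<Longrightarrow> t \<in> {0..L} \<Longrightarrow> (norm (z s - z t))\<^sup>2 \<le> C * (circle_dist L s t)\<^sup>2"
    "\<And>s t \<epsilon>. s \<in> {0..L} \<Longrightarrow> t \<in> {0..L} \<Longrightarrow>
       (circle_dist L s t)\<^sup>2 + \<epsilon>\<^sup>2 * (norm (z s - z t))\<^sup>2 \<le> (distance_along L (bending r z \<epsilon>) s t)\<^sup>2"
    "\<And>s t \<epsilon>. s \<in> {0..L} \<Longrightarrow> t \<in> {0..L} \<Longrightarrow>
       (distance_along L (bending r z \<epsilon>) s t)\<^sup>2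
         \<le> (circle_dist L s t)\<^sup>2 + \<epsilon>\<^sup>2 * (norm (z s - z t))\<^sup>2 + \<epsilon>\<^sup>2 * (C * circle_dist L s t ^ 4)"
    "\<And>s. s \<in> {0..L} \<Longrightarrow> (norm (velocity z s))\<^sup>2 \<le> C"
proof -
  have per: "r (s + L) = r s" "z (s + L) = z s" for s
    using K B by (auto simp: arc_length_knot_def infinitesimal_bending_field_def smooth_on_circle_def)
  obtain C where C: "1 \<le> C"
    "\<And>x y. 0 \<le> x \<Longrightarrow> x \<le> y \<Longrightarrow> y \<le> 2 * L \<Longrightarrow> \<bar>(norm (r y - r x))\<^sup>2 - (y - x)\<^sup>2\<bar> \<le> C * (y - x) ^ 4"
    "\<And>x y. 0 \<le> x \<Longrightarrow> x \<le> y \<Longrightarrow> y \<le> 2 * L \<Longrightarrow> \<bar>(r y - r x) \<bullet> (z y - z x)\<bar> \<le> C * (y - x) ^ 4"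
    "\<And>x y. 0 \<le> x \<Longrightarrow> x \<le> y \<Longrightarrow> y \<le> 2 * L \<Longrightarrow> (norm (z y - z x))\<^sup>2 \<le> C * (y - x)\<^sup>2"
    "\<And>x y \<epsilon>. 0 \<le> x \<Longrightarrow> x \<le> y \<Longrightarrow> y \<le> 2 * L \<Longrightarrow>
       (y - x)\<^sup>2 + \<epsilon>\<^sup>2 * (norm (z y - z x))\<^sup>2 \<le> (arc_length (bending r z \<epsilon>) x y)\<^sup>2"
    "\<And>x y \<epsilon>. 0 \<le> x \<Longrightarrow> x \<le> y \<Longrightarrow> y \<le> 2 * L \<Longrightarrow>
       (arc_length (bending r z \<epsilon>) x y)\<^sup>2
         \<le> (y - x)\<^sup>2 + \<epsilon>\<^sup>2 * (norm (z y - z x))\<^sup>2 + \<epsilon>\<^sup>2 * (C * (y - x) ^ 4)"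
    "\<And>u. 0 \<le> u \<Longrightarrow> u \<le> 2 * L \<Longrightarrow> (norm (velocity z u))\<^sup>2 \<le> C"
    using arc_estimates[OF K B, of 0 "2 * L"] by blast
  have nonneg: "0 \<le> arc_length \<gamma> x y" for \<gamma> :: "real \<Rightarrow> real^3" and x y
    unfolding arc_length_def set_lebesgue_integral_def by (intro integral_nonneg_AE) auto
  show thesis
  proof (rule that[OF C(1)])
    fix s t \<epsilon> :: real assume st: "s \<in> {0..L}" "t \<in> {0..L}"
    define x where "x = min s t"
    define y where "y = max s t"
    have xy: "0 \<le> x" "x \<le> y" "y \<le> L" using st by (auto simp: x_def y_def)
    then have arcs: "0 \<le> x" "x \<le> y" "y \<le> 2 * L" "0 \<le> y" "y \<le> x + L" "x + L \<le> 2 * L" by auto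
    define h where "h = circle_dist L s t"
    have abs: "\<bar>s - t\<bar> = y - x" by (auto simp: x_def y_def)
    have h: "h = min (y - x) (x + L - y)"
      by (simp add: h_def circle_dist_def abs algebra_simps)
    have sym: "norm (r s - r t) = norm (r y - r x)" "norm (z s - z t) = norm (z y - z x)"
      "(r s - r t) \<bullet> (z s - z t) = (r y - r x) \<bullet> (z y - z x)"
      by (auto simp: x_def y_def min_def max_def norm_minus_commute inner_diff_left inner_diff_right)
    have sym': "norm (r s - r t) = norm (r (x + L) - r y)" "norm (z s - z t) = norm (z (x + L) - z y)"
      "(r s - r t) \<bullet> (z s - z t) = (r (x + L) - r y) \<bullet> (z (x + L) - z y)"
      unfolding sym per by (auto simp: norm_minus_commute inner_diff_left inner_diff_right)
    have dichotomy: "h = y - x \<or> h = x + L - y" unfolding h by linarith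
    from dichotomy show "\<bar>(norm (r s - r t))\<^sup>2 - (circle_dist L s t)\<^sup>2\<bar> \<le> C * circle_dist L s t ^ 4"
      unfolding h_def[symmetric]
      by (elim disjE) (simp_all only: C(2)[OF arcs(1-3), folded sym] C(2)[OF arcs(4-6), folded sym'])
    from dichotomy show "\<bar>(r s - r t) \<bullet> (z s - z t)\<bar> \<le> C * circle_dist L s t ^ 4"
      unfolding h_def[symmetric]
      by (elim disjE) (simp_all only: C(3)[OF arcs(1-3), folded sym] C(3)[OF arcs(4-6), folded sym'])
    from dichotomy show "(norm (z s - z t))\<^sup>2 \<le> C * (circle_dist L s t)\<^sup>2"
      unfolding h_def[symmetric]
      by (elim disjE) (simp_all only: C(4)[OF arcs(1-3), folded sym] C(4)[OF arcs(4-6), folded sym'])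
    define D where "D = distance_along L (bending r z \<epsilon>) s t"
    have D: "D = min (arc_length (bending r z \<epsilon>) x y) (arc_length (bending r z \<epsilon>) y (x + L))"
      by (simp add: D_def distance_along_def x_def y_def)
    have D0: "0 \<le> D" unfolding D by (intro min.boundedI nonneg)
    have h0: "0 \<le> h" using xy unfolding h by auto
    note lo = C(5)[OF arcs(1-3), of \<epsilon>, folded sym] C(5)[OF arcs(4-6), of \<epsilon>, folded sym']
    note up = C(6)[OF arcs(1-3), of \<epsilon>, folded sym] C(6)[OF arcs(4-6), of \<epsilon>, folded sym']
    have "h\<^sup>2 \<le> (y - x)\<^sup>2" "h\<^sup>2 \<le> (x + L - y)\<^sup>2"
      using h0 by (auto intro!: power_mono simp: h)
    then have "h\<^sup>2 + \<epsilon>\<^sup>2 * (norm (z s - z t))\<^sup>2 \<le> D\<^sup>2"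
      using lo unfolding D min_def by auto
    then show "(circle_dist L s t)\<^sup>2 + \<epsilon>\<^sup>2 * (norm (z s - z t))\<^sup>2 \<le> (distance_along L (bending r z \<epsilon>) s t)\<^sup>2"
      by (simp only: h_def D_def)
    have le: "D\<^sup>2 \<le> (arc_length (bending r z \<epsilon>) x y)\<^sup>2" "D\<^sup>2 \<le> (arc_length (bending r z \<epsilon>) y (x + L))\<^sup>2"
      using D0 by (auto intro!: power_mono simp: D)
    from dichotomy have "D\<^sup>2 \<le> h\<^sup>2 + \<epsilon>\<^sup>2 * (norm (z s - z t))\<^sup>2 + \<epsilon>\<^sup>2 * (C * h ^ 4)"
    proof
      assume 1: "h = y - x"
      show ?thesis using order_trans[OF le(1) up(1)] by (simp only: 1)
    next
      assume 2: "h = x + L - y"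
      show ?thesis using order_trans[OF le(2) up(2)] by (simp only: 2)
    qed
    then show "(distance_along L (bending r z \<epsilon>) s t)\<^sup>2
         \<le> (circle_dist L s t)\<^sup>2 + \<epsilon>\<^sup>2 * (norm (z s - z t))\<^sup>2 + \<epsilon>\<^sup>2 * (C * circle_dist L s t ^ 4)"
      by (simp only: h_def D_def)
  next
    fix s assume "s \<in> {0..L}"
    then show "(norm (velocity z s))\<^sup>2 \<le> C" by (intro C(7)) auto
  qed
qed

lemma circle_dist_bounds:
  assumes "s \<in> {0..L}" "t \<in> {0..L}"
  shows "0 \<le> circle_dist L s t" "circle_dist L s t \<le> L"
  using assms by (auto simp: circle_dist_def)

text \<open>For nearby points the chord is comparable with the distance because their squares differ by a
  term of fourth order; for the others injectivity and compactness bound the chord from below.\<close>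

lemma chord_lower_bound:
  assumes K: "arc_length_knot L r" and B: "infinitesimal_bending_field L r z"
  obtains k where "0 < k"
    "\<And>s t. s \<in> {0..L} \<Longrightarrow> t \<in> {0..L} \<Longrightarrow> k * (circle_dist L s t)\<^sup>2 \<le> (norm (r s - r t))\<^sup>2"
proof -
  have L: "0 < L" and r: "smooth r" and per: "\<And>s. r (s + L) = r s" and inj: "inj_on r {0..<L}"
    using K by (auto simp: arc_length_knot_def smooth_on_circle_def)
  obtain C where C: "1 \<le> C" "\<And>s t. s \<in> {0..L} \<Longrightarrow> t \<in> {0..L} \<Longrightarrow>
       \<bar>(norm (r s - r t))\<^sup>2 - (circle_dist L s t)\<^sup>2\<bar> \<le> C * circle_dist L s t ^ 4"
    by (rule circle_estimates[OF K B], rule that, assumption, blast)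
  define T where "T = ({0..L} \<times> {0..L}) \<inter> {p. 1 / (2 * C) \<le> (circle_dist L (fst p) (snd p))\<^sup>2}"
  have "closed {p. 1 / (2 * C) \<le> (circle_dist L (fst p) (snd p))\<^sup>2}"
    unfolding circle_dist_def by (intro closed_Collect_le continuous_intros)
  then have T: "compact T" unfolding T_def by (intro compact_Int_closed compact_Times compact_Icc)
  have pos: "0 < (norm (r (fst p) - r (snd p)))\<^sup>2" if p: "p \<in> T" for p
  proof -
    obtain s t where st: "p = (s, t)" "s \<in> {0..L}" "t \<in> {0..L}" "1 / (2 * C) \<le> (circle_dist L s t)\<^sup>2"
      using p by (auto simp: T_def)
    have "circle_dist L s t \<noteq> 0" using st(4) C(1) by auto
    then have ne: "s \<noteq> t" "\<not> (s = 0 \<and> t = L)" "\<not> (s = L \<and> t = 0)"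
      using L by (auto simp: circle_dist_def)
    \<comment> \<open>\<open>L\<close> and \<open>0\<close> name the same point, and injectivity is known on the half-open interval.\<close>
    define w where "w = (\<lambda>u. if u = L then 0 else u)"
    have "r (w u) = r u" for u using per[of 0] by (simp add: w_def)
    moreover have "w s \<in> {0..<L}" "w t \<in> {0..<L}" "w s \<noteq> w t"
      using st ne L by (auto simp: w_def)
    ultimately have "r s \<noteq> r t" using inj by (metis inj_onD)
    then show ?thesis by (simp add: st)
  qed
  obtain \<mu> where \<mu>: "0 < \<mu>" "\<And>p. p \<in> T \<Longrightarrow> \<mu> \<le> (norm (r (fst p) - r (snd p)))\<^sup>2"
  proof (cases "T = {}")
    case True
    then show thesis by (intro that[of 1]) auto
  next
    case False
    have "continuous_on T (\<lambda>p. (norm (r (fst p) - r (snd p)))\<^sup>2)"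
      by (intro continuous_intros continuous_on_compose2[OF smooth_continuous_on[OF r, of UNIV]]) auto
    from continuous_attains_inf[OF T False this]
    obtain p0 where "p0 \<in> T" "\<And>p. p \<in> T \<Longrightarrow> (norm (r (fst p0) - r (snd p0)))\<^sup>2 \<le> (norm (r (fst p) - r (snd p)))\<^sup>2"
      by blast
    then show thesis using pos by (intro that[of "(norm (r (fst p0) - r (snd p0)))\<^sup>2"])
  qed
  show thesis
  proof (rule that)
    show "0 < min (1/2) (\<mu> / L\<^sup>2)" using \<mu> L by simp
    fix s t assume st: "s \<in> {0..L}" "t \<in> {0..L}"
    define h where "h = circle_dist L s t"
    have h: "0 \<le> h" "h \<le> L" using circle_dist_bounds[OF st] by (auto simp: h_def)
    show "min (1/2) (\<mu> / L\<^sup>2) * (circle_dist L s t)\<^sup>2 \<le> (norm (r s - r t))\<^sup>2"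
    proof (cases "(s, t) \<in> T")
      case True
      have "min (1/2) (\<mu> / L\<^sup>2) * h\<^sup>2 \<le> \<mu> / L\<^sup>2 * L\<^sup>2"
        using h \<mu> by (intro mult_mono power_mono) auto
      also have "\<dots> = \<mu>" using L by simp
      also have "\<mu> \<le> (norm (r s - r t))\<^sup>2" using \<mu>(2)[OF True] by simp
      finally show ?thesis by (simp add: h_def)
    next
      case False
      then have "h\<^sup>2 \<le> 1 / (2 * C)" using st by (auto simp: T_def h_def)
      then have "C * h ^ 4 \<le> C * (1 / (2 * C) * h\<^sup>2)"
        using C(1) mult_right_mono[of "h\<^sup>2" "1 / (2 * C)" "h\<^sup>2"]
        by (intro mult_left_mono) (auto simp: power_numeral_reduce)
      also have "\<dots> = h\<^sup>2 / 2" using C(1) by simp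
      finally have "h\<^sup>2 / 2 \<le> (norm (r s - r t))\<^sup>2"
        using C(2)[OF st] unfolding h_def[symmetric] by linarith
      moreover have "min (1/2) (\<mu> / L\<^sup>2) * h\<^sup>2 \<le> 1 / 2 * h\<^sup>2"
        by (rule mult_right_mono[OF min.cobounded1 zero_le_power2])
      ultimately show ?thesis by (simp add: h_def)
    qed
  qed
qed

section \<open>First variation of the energy\<close>

text \<open>By the estimates on the circle and the lower bound for chords, the rescaled variables of the
  normalized density stay in a fixed compact box, uniformly up to the diagonal and up to the corners, where \<open>s\<close> and \<open>t\<close>
  are \<open>0\<close> and \<open>L\<close>.\<close>

lemma moebius_integrand_expansion:
  assumes K: "arc_length_knot L r" and B: "infinitesimal_bending_field L r z"
  obtains e0 C where "0 < e0"
    "\<And>s t. s \<in> {0..L} \<Longrightarrow> t \<in> {0..L} \<Longrightarrow> \<bar>moebius_integrand L (bending r z 0) (s, t)\<bar> \<le> C"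
    "\<And>s t. s \<in> {0..L} \<Longrightarrow> t \<in> {0..L} \<Longrightarrow> \<bar>variation_integrand r z (s, t)\<bar> \<le> C"
    "\<And>\<epsilon> s t. \<bar>\<epsilon>\<bar> \<le> e0 \<Longrightarrow> s \<in> {0..L} \<Longrightarrow> t \<in> {0..L} \<Longrightarrow>
       \<bar>moebius_integrand L (bending r z \<epsilon>) (s, t) - moebius_integrand L (bending r z 0) (s, t)
          - \<epsilon> * (2 * variation_integrand r z (s, t))\<bar> \<le> C * \<epsilon>\<^sup>2"
proof -
  obtain C where C: "1 \<le> C"
    "\<And>s t. s \<in> {0..L} \<Longrightarrow> t \<in> {0..L} \<Longrightarrow>
       \<bar>(norm (r s - r t))\<^sup>2 - (circle_dist L s t)\<^sup>2\<bar> \<le> C * circle_dist L s t ^ 4"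
    "\<And>s t. s \<in> {0..L} \<Longrightarrow> t \<in> {0..L} \<Longrightarrow>
       \<bar>(r s - r t) \<bullet> (z s - z t)\<bar> \<le> C * circle_dist L s t ^ 4"
    "\<And>s t. s \<in> {0..L} \<Longrightarrow> t \<in> {0..L} \<Longrightarrow> (norm (z s - z t))\<^sup>2 \<le> C * (circle_dist L s t)\<^sup>2"
    "\<And>s t \<epsilon>. s \<in> {0..L} \<Longrightarrow> t \<in> {0..L} \<Longrightarrow>
       (circle_dist L s t)\<^sup>2 + \<epsilon>\<^sup>2 * (norm (z s - z t))\<^sup>2 \<le> (distance_along L (bending r z \<epsilon>) s t)\<^sup>2"
    "\<And>s t \<epsilon>. s \<in> {0..L} \<Longrightarrow> t \<in> {0..L} \<Longrightarrow>
       (distance_along L (bending r z \<epsilon>) s t)\<^sup>2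
         \<le> (circle_dist L s t)\<^sup>2 + \<epsilon>\<^sup>2 * (norm (z s - z t))\<^sup>2 + \<epsilon>\<^sup>2 * (C * circle_dist L s t ^ 4)"
    "\<And>s. s \<in> {0..L} \<Longrightarrow> (norm (velocity z s))\<^sup>2 \<le> C"
    using circle_estimates[OF K B] by blast
  obtain k where k: "0 < k"
    "\<And>s t. s \<in> {0..L} \<Longrightarrow> t \<in> {0..L} \<Longrightarrow> k * (circle_dist L s t)\<^sup>2 \<le> (norm (r s - r t))\<^sup>2"
    using chord_lower_bound[OF K B] by blast
  define C1 where "C1 = C + (1 + C * L\<^sup>2) + L\<^sup>2"
  have "0 \<le> C * L\<^sup>2" using C(1) by simp
  then have C1: "1 \<le> C1" "C \<le> C1" "1 + C * L\<^sup>2 \<le> C1" "L\<^sup>2 \<le> C1"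
    using C(1) zero_le_power2[of L] unfolding C1_def by linarith+
  obtain e0 K where e0: "0 < e0" and ex: "\<And>\<epsilon> \<alpha> \<beta> \<gamma> \<eta> \<kappa> \<nu> H.
     \<bar>\<epsilon>\<bar> \<le> e0 \<Longrightarrow> k \<le> \<alpha> \<Longrightarrow> \<bar>\<alpha>\<bar> \<le> C1 \<Longrightarrow> \<bar>\<beta>\<bar> \<le> C1 \<Longrightarrow> 0 \<le> \<gamma> \<Longrightarrow> \<gamma> \<le> C1 \<Longrightarrow> 0 \<le> \<eta> \<Longrightarrow> \<eta> \<le> C1
     \<Longrightarrow> \<bar>\<kappa>\<bar> \<le> C1 \<Longrightarrow> 0 \<le> \<nu> \<Longrightarrow> \<nu> \<le> C1 \<Longrightarrow> 0 \<le> H \<Longrightarrow> H \<le> C1 \<Longrightarrow> \<alpha> + \<kappa> * H = 1 \<Longrightarrow>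
     0 < \<alpha> + 2 * \<epsilon> * \<beta> * H + \<epsilon>\<^sup>2 * \<gamma> \<and>
     \<bar>(1 + \<epsilon>\<^sup>2 * \<nu>) * (\<kappa> - 2 * \<epsilon> * \<beta> + \<epsilon>\<^sup>2 * \<eta>)
        / ((\<alpha> + 2 * \<epsilon> * \<beta> * H + \<epsilon>\<^sup>2 * \<gamma>) * (1 + \<epsilon>\<^sup>2 * \<gamma> + \<epsilon>\<^sup>2 * \<eta> * H))
       - \<kappa> / \<alpha> + 2 * \<epsilon> * \<beta> / \<alpha>\<^sup>2\<bar> \<le> K * \<epsilon>\<^sup>2"
    using energy_density_expansion[OF k(1) C1(1)] by metis
  define C2 where "C2 = max 0 K + C1 / k + C1 / k\<^sup>2"
  have "0 \<le> C1 / k" "0 \<le> C1 / k\<^sup>2" using k(1) C1(1) by auto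
  then have C2: "0 \<le> C2" "K \<le> C2" "C1 / k \<le> C2" "C1 / k\<^sup>2 \<le> C2"
    using \<open>0 \<le> C1 / k\<close> \<open>0 \<le> C1 / k\<^sup>2\<close> max.cobounded1[of 0 K] max.cobounded2[of K 0]
    unfolding C2_def by linarith+
  have main: "\<bar>moebius_integrand L (bending r z 0) (s, t)\<bar> \<le> C2 \<and>
      \<bar>variation_integrand r z (s, t)\<bar> \<le> C2 \<and>
      \<bar>moebius_integrand L (bending r z \<epsilon>) (s, t) - moebius_integrand L (bending r z 0) (s, t)
          - \<epsilon> * (2 * variation_integrand r z (s, t))\<bar> \<le> C2 * \<epsilon>\<^sup>2"
    if \<epsilon>: "\<bar>\<epsilon>\<bar> \<le> e0" and st: "s \<in> {0..L}" "t \<in> {0..L}" for \<epsilon> s t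
  proof -
    define a where "a = (norm (r s - r t))\<^sup>2"
    define b where "b = (r s - r t) \<bullet> (z s - z t)"
    define c where "c = (norm (z s - z t))\<^sup>2"
    define H where "H = (circle_dist L s t)\<^sup>2"
    define D where "D = (\<lambda>\<epsilon>. (distance_along L (bending r z \<epsilon>) s t)\<^sup>2)"
    define V where "V = (\<lambda>\<epsilon>. sqrt (1 + \<epsilon>\<^sup>2 * (norm (velocity z s))\<^sup>2) * sqrt (1 + \<epsilon>\<^sup>2 * (norm (velocity z t))\<^sup>2))"
    have H4: "circle_dist L s t ^ 4 = H\<^sup>2" by (simp add: H_def flip: power_mult)
    have H: "0 \<le> H" "H \<le> L\<^sup>2"
      using circle_dist_bounds[OF st] by (auto simp: H_def intro: power_mono)
    have est: "\<bar>a - H\<bar> \<le> C * H\<^sup>2" "\<bar>b\<bar> \<le> C * H\<^sup>2" "0 \<le> c" "c \<le> C * H" "k * H \<le> a"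
      "H + e\<^sup>2 * c \<le> D e" "D e \<le> H + e\<^sup>2 * c + e\<^sup>2 * (C * H\<^sup>2)" for e
      unfolding a_def b_def c_def D_def H_def H4[unfolded H_def, symmetric]
      by (rule C(2-6)[OF st] k(2)[OF st] zero_le_power2)+
    have P: "(norm (bending r z e s - bending r z e t))\<^sup>2 = a + 2 * e * b + e\<^sup>2 * c" for e
    proof -
      have "bending r z e s - bending r z e t = (r s - r t) + e *\<^sub>R (z s - z t)"
        by (simp add: bending_def algebra_simps)
      then show ?thesis
        unfolding a_def b_def c_def power2_norm_eq_inner
        by (simp add: inner_add_left inner_add_right inner_commute[of "z s - z t" "r s - r t"] power2_eq_square distrib_left mult.assoc)
    qed
    have m: "moebius_integrand L (bending r z e) (s, t) = (1 / (a + 2 * e * b + e\<^sup>2 * c) - 1 / D e) * V e" for e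
      unfolding moebius_integrand_def prod.case speed_bending[OF K B] P D_def V_def by simp
    have v: "variation_integrand r z (s, t) = - b / a\<^sup>2"
    proof -
      have "norm (r s - r t) ^ 4 = a\<^sup>2" by (simp add: a_def flip: power_mult)
      then show ?thesis
        unfolding variation_integrand_def prod.case b_def
        by (simp add: inner_diff_left)
    qed
    have V: "1 \<le> V e" "V e \<le> 1 + e\<^sup>2 * C" for e
    proof -
      have u: "1 \<le> sqrt (1 + e\<^sup>2 * (norm (velocity z w))\<^sup>2)"
        "sqrt (1 + e\<^sup>2 * (norm (velocity z w))\<^sup>2) \<le> sqrt (1 + e\<^sup>2 * C)" if "w \<in> {0..L}" for w
        using C(7)[OF that] by (auto intro!: mult_left_mono)
      have "1 * 1 \<le> V e" unfolding V_def by (intro mult_mono u st) auto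
      then show "1 \<le> V e" by simp
      have "V e \<le> sqrt (1 + e\<^sup>2 * C) * sqrt (1 + e\<^sup>2 * C)"
        unfolding V_def using C(1) by (intro mult_mono u st) auto
      also have "\<dots> = 1 + e\<^sup>2 * C" using C(1) by simp
      finally show "V e \<le> 1 + e\<^sup>2 * C" .
    qed
    show ?thesis
    proof (cases "H = 0")
      case True
      \<comment> \<open>Here \<open>s\<close> and \<open>t\<close> are the same point of the circle, and division by zero gives zero.\<close>
      have "a = 0" "b = 0" "c = 0" using est(1-4) True by auto
      moreover from this have "D e = 0" for e using est(6,7)[of e] True by auto
      ultimately show ?thesis using C2(1) by (simp add: m v)
    next
      case False
      with H have Hpos: "0 < H" by simp
      define \<alpha> where "\<alpha> = a / H"
      define \<beta> where "\<beta> = b / H\<^sup>2"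
      define \<gamma> where "\<gamma> = c / H"
      define \<kappa> where "\<kappa> = (1 - \<alpha>) / H"
      \<comment> \<open>For \<open>\<epsilon> = 0\<close> the next two quantities are multiplied by \<open>0\<close> wherever they occur, and any
        value in the box will do.\<close>
      define \<eta> where "\<eta> = (if \<epsilon> = 0 then 0 else (D \<epsilon> - H - \<epsilon>\<^sup>2 * c) / (\<epsilon>\<^sup>2 * H\<^sup>2))"
      define \<nu> where "\<nu> = (if \<epsilon> = 0 then 0 else (V \<epsilon> - 1) / \<epsilon>\<^sup>2)"
      have abc: "a = H * \<alpha>" "b = H\<^sup>2 * \<beta>" "c = H * \<gamma>" "\<alpha> = 1 - \<kappa> * H"
        using Hpos by (auto simp: \<alpha>_def \<beta>_def \<gamma>_def \<kappa>_def)
      have D0: "D 0 = H" "V 0 = 1" using est(6,7)[of 0] V[of 0] by auto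
      have De: "D \<epsilon> = H * (1 + \<epsilon>\<^sup>2 * \<gamma> + \<epsilon>\<^sup>2 * \<eta> * H)"
        using D0 Hpos by (auto simp: \<eta>_def abc field_simps power2_eq_square)
      have Ve: "V \<epsilon> = 1 + \<epsilon>\<^sup>2 * \<nu>"
        using D0 by (auto simp: \<nu>_def)
      have \<kappa>: "\<bar>\<kappa>\<bar> \<le> C"
      proof -
        have "a - H = - (H\<^sup>2 * \<kappa>)" by (simp add: abc power2_eq_square algebra_simps)
        then have "H\<^sup>2 * \<bar>\<kappa>\<bar> \<le> H\<^sup>2 * C" using est(1) by (simp add: abs_mult mult.commute)
        then show ?thesis using Hpos by simp
      qed
      have \<beta>: "\<bar>\<beta>\<bar> \<le> C" using est(2) Hpos by (simp add: abc abs_mult mult.commute)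
      have \<gamma>: "0 \<le> \<gamma>" "\<gamma> \<le> C" using est(3,4) Hpos by (simp_all add: abc mult.commute zero_le_mult_iff)
      have \<alpha>: "k \<le> \<alpha>" using est(5) Hpos by (simp add: abc(1) mult.commute)
      have "\<bar>\<kappa> * H\<bar> \<le> C * L\<^sup>2" unfolding abs_mult using \<kappa> H C(1) by (intro mult_mono) auto
      then have \<alpha>': "\<bar>\<alpha>\<bar> \<le> C1" using abc(4) C1(3) by linarith
      have \<eta>: "0 \<le> \<eta>" "\<eta> \<le> C"
        using est(6,7)[of \<epsilon>] Hpos C(1) by (auto simp: \<eta>_def divide_simps algebra_simps)
      have \<nu>: "0 \<le> \<nu>" "\<nu> \<le> C"
        using V[of \<epsilon>] C(1) by (auto simp: \<nu>_def divide_simps algebra_simps)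
      define p where "p = \<alpha> + 2 * \<epsilon> * \<beta> * H + \<epsilon>\<^sup>2 * \<gamma>"
      define q where "q = 1 + \<epsilon>\<^sup>2 * \<gamma> + \<epsilon>\<^sup>2 * \<eta> * H"
      have E: "0 < p" "\<bar>(1 + \<epsilon>\<^sup>2 * \<nu>) * (\<kappa> - 2 * \<epsilon> * \<beta> + \<epsilon>\<^sup>2 * \<eta>) / (p * q)
         - \<kappa> / \<alpha> + 2 * \<epsilon> * \<beta> / \<alpha>\<^sup>2\<bar> \<le> K * \<epsilon>\<^sup>2"
        unfolding p_def q_def
        using ex[of \<epsilon> \<alpha> \<beta> \<gamma> \<eta> \<kappa> \<nu> H] \<epsilon> \<alpha> \<alpha>' \<beta> \<gamma> \<eta> \<kappa> \<nu> H C1 abc(4) by auto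
      have qpos: "0 < q" using \<gamma>(1) \<eta>(1) H by (simp add: q_def add_pos_nonneg)
      have "1 / (H * p) - 1 / (H * q) = (q - p) / (H * (p * q))"
        using Hpos E(1) qpos by (simp add: field_simps)
      also have "q - p = H * (\<kappa> - 2 * \<epsilon> * \<beta> + \<epsilon>\<^sup>2 * \<eta>)"
        by (simp add: p_def q_def abc(4) algebra_simps)
      finally have "1 / (H * p) - 1 / (H * q) = (\<kappa> - 2 * \<epsilon> * \<beta> + \<epsilon>\<^sup>2 * \<eta>) / (p * q)"
        using Hpos by simp
      moreover have "a + 2 * \<epsilon> * b + \<epsilon>\<^sup>2 * c = H * p"
        by (simp add: p_def abc(1-3) algebra_simps power2_eq_square)
      ultimately have m1: "moebius_integrand L (bending r z \<epsilon>) (s, t)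
          = (1 + \<epsilon>\<^sup>2 * \<nu>) * (\<kappa> - 2 * \<epsilon> * \<beta> + \<epsilon>\<^sup>2 * \<eta>) / (p * q)"
        unfolding m De Ve q_def[symmetric] by simp
      have \<alpha>pos: "0 < \<alpha>" using \<alpha> k(1) by simp
      have m0: "moebius_integrand L (bending r z 0) (s, t) = \<kappa> / \<alpha>"
      proof -
        have "1 / (H * \<alpha>) - 1 / H = \<kappa> / \<alpha>"
          using \<alpha>pos Hpos by (simp add: \<kappa>_def field_simps)
        then show ?thesis by (simp add: m D0 abc(1))
      qed
      have v': "variation_integrand r z (s, t) = - \<beta> / \<alpha>\<^sup>2"
        using Hpos by (simp add: v abc(1,2) power_mult_distrib)
      have "\<bar>\<kappa> / \<alpha>\<bar> \<le> C1 / k"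
        unfolding abs_divide using \<kappa> \<alpha> \<alpha>pos k(1) C1 by (intro frac_le) auto
      moreover have "\<bar>- \<beta> / \<alpha>\<^sup>2\<bar> \<le> C1 / k\<^sup>2"
        unfolding abs_divide using \<beta> \<alpha> \<alpha>pos k(1) C1 by (intro frac_le) (auto intro: power_mono)
      moreover have "K * \<epsilon>\<^sup>2 \<le> C2 * \<epsilon>\<^sup>2" by (intro mult_right_mono C2) auto
      ultimately show ?thesis
        using E(2) C2(3,4) unfolding m0 m1 v' by (auto simp: algebra_simps)
    qed
  qed
  show thesis
    using that[OF e0, of C2] main main[of 0] e0 by simp
qed

text \<open>Measurability of the distance along the curve comes from a global antiderivative of the speed,
  which turns arc lengths into differences of a continuous function.\<close>

lemma set_integrable_moebius_integrand:
  assumes \<gamma>: "continuous_on UNIV \<gamma>" and \<gamma>': "continuous_on UNIV (velocity \<gamma>)"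
    and bound: "\<And>s t. s \<in> {0..L} \<Longrightarrow> t \<in> {0..L} \<Longrightarrow> \<bar>moebius_integrand L \<gamma> (s, t)\<bar> \<le> C"
  shows "set_integrable lborel ({0..L} \<times> {0..L}) (moebius_integrand L \<gamma>)"
proof -
  obtain F where F: "\<And>u. (F has_vector_derivative norm (velocity \<gamma> u)) (at u)"
    and len: "\<And>a b. a \<le> b \<Longrightarrow> arc_length \<gamma> a b = F b - F a"
    by (rule arc_length_antiderivative[OF \<gamma>']) blast
  have Fc: "continuous_on UNIV F"
    unfolding continuous_on_eq_continuous_at[OF open_UNIV]
    by (intro ballI) (rule has_vector_derivative_continuous[OF F])
  define D where "D = (\<lambda>p. min (F (max (fst p) (snd p)) - F (min (fst p) (snd p)))
    (F (min (fst p) (snd p) + L) - F (max (fst p) (snd p))))"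
  have cD: "continuous_on UNIV D"
    unfolding D_def by (intro continuous_intros continuous_on_compose2[OF Fc]) auto
  have cN: "continuous_on UNIV (\<lambda>p. norm (\<gamma> (fst p) - \<gamma> (snd p)))"
    by (intro continuous_intros continuous_on_compose2[OF \<gamma>]) auto
  have cV: "continuous_on UNIV (\<lambda>p. norm (velocity \<gamma> (fst p)))" "continuous_on UNIV (\<lambda>p. norm (velocity \<gamma> (snd p)))"
    by (intro continuous_intros continuous_on_compose2[OF \<gamma>']; auto)+
  note [measurable] = borel_measurable_continuous_onI[OF cD] borel_measurable_continuous_onI[OF cN]
    borel_measurable_continuous_onI[OF cV(1)] borel_measurable_continuous_onI[OF cV(2)]
  define g where "g = (\<lambda>p. (1 / (norm (\<gamma> (fst p) - \<gamma> (snd p)))\<^sup>2 - 1 / (D p)\<^sup>2)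
       * norm (velocity \<gamma> (fst p)) * norm (velocity \<gamma> (snd p)))"
  have g: "g \<in> borel_measurable lborel" unfolding g_def by measurable
  have eq: "moebius_integrand L \<gamma> p = g p" if "p \<in> {0..L} \<times> {0..L}" for p
  proof -
    obtain s t where "p = (s, t)" "s \<in> {0..L}" "t \<in> {0..L}" using \<open>p \<in> _\<close> by auto
    moreover from this have "max s t \<le> min s t + L" by auto
    ultimately show ?thesis
      by (simp add: g_def D_def moebius_integrand_def distance_along_def len)
  qed
  have "set_integrable lborel ({0..L} \<times> {0..L}) g"
    unfolding set_integrable_def
  proof (rule integrableI_bounded_set_indicator[OF _ g])
    show "AE p in lborel. p \<in> {0..L} \<times> {0..L} \<longrightarrow> norm (g p) \<le> C"
      using bound eq by (intro AE_I2) auto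
    have "emeasure lborel (cbox (0::real, 0::real) (L, L)) < \<infinity>" by (rule emeasure_lborel_cbox_finite)
    then show "emeasure lborel ({0..L} \<times> {0..L}) < \<infinity>" by (simp add: cbox_Pair_eq)
    have "{0..L} \<times> {0..L} = cbox (0::real, 0::real) (L, L)" by (simp add: cbox_Pair_eq)
    then show "{0..L} \<times> {0..L} \<in> sets lborel" by simp
  qed
  then show ?thesis using eq by (subst set_integrable_cong[OF refl refl]) auto
qed

theorem theorem4p1:
  fixes L :: real and r z :: "real \<Rightarrow> real^3"
  assumes "arc_length_knot L r"
    and "infinitesimal_bending_field L r z"
  shows "(\<forall>\<^sub>F \<epsilon> in nhds 0. set_integrable lborel ({0..L} \<times> {0..L})
            (moebius_integrand L (bending r z \<epsilon>)))
    \<and> set_integrable lborel ({0..L} \<times> {0..L}) (variation_integrand r z)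
    \<and> ((\<lambda>\<epsilon>. moebius_energy L (bending r z \<epsilon>)) has_real_derivative
        2 * set_lebesgue_integral lborel ({0..L} \<times> {0..L}) (variation_integrand r z)) (at 0)"
proof -
  let ?Q = "{0..L} \<times> {0..L}"
  have r: "smooth r" and z: "smooth z"
    using assms by (auto simp: arc_length_knot_def infinitesimal_bending_field_def smooth_on_circle_def)
  have Q: "?Q = cbox (0, 0) (L, L)" by (simp add: cbox_Pair_eq)
  have Q': "?Q \<in> sets lborel" "emeasure lborel ?Q < \<infinity>"
    unfolding Q by (simp, rule emeasure_lborel_cbox_finite)
  obtain e0 C where e0: "0 < e0"
    and m0: "\<And>s t. s \<in> {0..L} \<Longrightarrow> t \<in> {0..L} \<Longrightarrow> \<bar>moebius_integrand L (bending r z 0) (s, t)\<bar> \<le> C"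
    and v: "\<And>s t. s \<in> {0..L} \<Longrightarrow> t \<in> {0..L} \<Longrightarrow> \<bar>variation_integrand r z (s, t)\<bar> \<le> C"
    and expansion: "\<And>\<epsilon> s t. \<bar>\<epsilon>\<bar> \<le> e0 \<Longrightarrow> s \<in> {0..L} \<Longrightarrow> t \<in> {0..L} \<Longrightarrow>
       \<bar>moebius_integrand L (bending r z \<epsilon>) (s, t) - moebius_integrand L (bending r z 0) (s, t)
          - \<epsilon> * (2 * variation_integrand r z (s, t))\<bar> \<le> C * \<epsilon>\<^sup>2"
    by (rule moebius_integrand_expansion[OF assms]) blast
  have m: "set_integrable lborel ?Q (moebius_integrand L (bending r z \<epsilon>))" if \<epsilon>: "\<bar>\<epsilon>\<bar> \<le> e0" for \<epsilon>
  proof (rule set_integrable_moebius_integrand)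
    have "continuous_on UNIV (\<lambda>s. r s + \<epsilon> *\<^sub>R z s)"
      by (intro continuous_intros smooth_continuous_on r z)
    then show "continuous_on UNIV (bending r z \<epsilon>)" by (simp add: bending_def)
    have "continuous_on UNIV (\<lambda>s. velocity r s + \<epsilon> *\<^sub>R velocity z s)"
      by (intro continuous_intros smooth_continuous_on smooth_velocity r z)
    then show "continuous_on UNIV (velocity (bending r z \<epsilon>))"
      by (simp only: velocity_bending[OF r z])
    fix s t assume st: "s \<in> {0..L}" "t \<in> {0..L}"
    have "\<bar>\<epsilon> * (2 * variation_integrand r z (s, t))\<bar> \<le> e0 * (2 * C)"
      unfolding abs_mult using \<epsilon> v[OF st] e0 by (intro mult_mono) auto
    then show "\<bar>moebius_integrand L (bending r z \<epsilon>) (s, t)\<bar> \<le> C * \<epsilon>\<^sup>2 + C + e0 * (2 * C)"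
      using expansion[OF \<epsilon> st] m0[OF st] by linarith
  qed
  have "continuous_on UNIV (\<lambda>p. (r (snd p) - r (fst p)) \<bullet> (z (fst p) - z (snd p)))"
    by (intro continuous_intros continuous_on_compose2[OF smooth_continuous_on[OF r, of UNIV]]
        continuous_on_compose2[OF smooth_continuous_on[OF z, of UNIV]]) auto
  moreover have "continuous_on UNIV (\<lambda>p. norm (r (fst p) - r (snd p)))"
    by (intro continuous_intros continuous_on_compose2[OF smooth_continuous_on[OF r, of UNIV]]) auto
  ultimately have [measurable]:
    "(\<lambda>p. (r (snd p) - r (fst p)) \<bullet> (z (fst p) - z (snd p))) \<in> borel_measurable borel"
    "(\<lambda>p. norm (r (fst p) - r (snd p))) \<in> borel_measurable borel"
    by (auto intro: borel_measurable_continuous_onI)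
  have vi: "set_integrable lborel ?Q (variation_integrand r z)"
    unfolding set_integrable_def
  proof (rule integrableI_bounded_set_indicator[OF Q'(1) _ Q'(2)])
    show "variation_integrand r z \<in> borel_measurable lborel"
      unfolding variation_integrand_def case_prod_unfold by measurable
    show "AE p in lborel. p \<in> ?Q \<longrightarrow> norm (variation_integrand r z p) \<le> C"
      using v by (intro AE_I2) auto
  qed
  have "((\<lambda>\<epsilon>. set_lebesgue_integral lborel ?Q (moebius_integrand L (bending r z \<epsilon>))) has_real_derivative
      set_lebesgue_integral lborel ?Q (\<lambda>p. 2 * variation_integrand r z p)) (at 0)"
  proof (rule set_integral_has_real_derivative_at_0[OF Q' e0 m])
    show "set_integrable lborel ?Q (\<lambda>p. 2 * variation_integrand r z p)" using vi by simp
    show "\<bar>moebius_integrand L (bending r z \<epsilon>) p - moebius_integrand L (bending r z 0) p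
          - \<epsilon> * (2 * variation_integrand r z p)\<bar> \<le> C * \<epsilon>\<^sup>2"
      if "\<bar>\<epsilon>\<bar> \<le> e0" "p \<in> ?Q" for \<epsilon> p
      using expansion[OF that(1)] that(2) by auto
  qed
  moreover have "\<forall>\<^sub>F \<epsilon> in nhds 0. set_integrable lborel ?Q (moebius_integrand L (bending r z \<epsilon>))"
    unfolding eventually_nhds_metric using e0 m by (auto simp: dist_norm intro!: exI[of _ e0])
  ultimately show ?thesis using vi by (simp add: moebius_energy_def)
qed

end
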